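(* Let $G$ be a group and let $H$ be a commensurated subgroup of $G$ such that $G$ is generated by finitely many cosets of $H$. (i) If $H$ is weakly separable in $G$, then there is a subgroup $N$ of $H$ that is normal in $G$ and has finite index in $H$. (ii) If $H$ is separable in $G$, then there is a subgroup $N$ of $H$ that is both normal and separable in $G$ and has finite index in $H$.
   Context: A subgroup $H$ of a group $G$ is commensurated if $[H : H \cap gHg^{-1}] < \infty$ for all $g \in G$. "$G$ is generated by finitely many cosets of $H$" means that there is a finite subset $Y \subseteq G$ with $G = \langle YH \rangle$. A subgroup $J \leq G$ is virtually normal if there is a subgroup $K \leq J$ of finite index in $J$ that is normal in $G$. A subgroup is weakly separable if it is an intersection of virtually normal subgroups of $G$; it is separable if it is an intersection of subgroups of finite index in $G$. *)

theory Defs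
  imports "HOL-Algebra.Generated_Groups"
begin

(* Finiteness of [H : K], for K a subgroup of H; meant only for such K. *)
definition finite_index :: "('a, 'b) monoid_scheme \<Rightarrow> 'a set \<Rightarrow> 'a set \<Rightarrow> bool" where
  "finite_index G H K \<longleftrightarrow> finite (rcosets\<^bsub>G\<lparr>carrier := H\<rparr>\<^esub> K)"

definition commensurated :: "('a, 'b) monoid_scheme \<Rightarrow> 'a set \<Rightarrow> bool" where
  "commensurated G H \<longleftrightarrow>
     subgroup H G \<and>
     (\<forall>g\<in>carrier G. finite_index G H (H \<inter> ((g <#\<^bsub>G\<^esub> H) #>\<^bsub>G\<^esub> inv\<^bsub>G\<^esub> g)))"

definition generated_by_finitely_many_cosets ::
    "('a, 'b) monoid_scheme \<Rightarrow> 'a set \<Rightarrow> bool" where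
  "generated_by_finitely_many_cosets G H \<longleftrightarrow>
     (\<exists>Y. finite Y \<and> Y \<subseteq> carrier G \<and> generate G (Y <#>\<^bsub>G\<^esub> H) = carrier G)"

definition virtually_normal :: "('a, 'b) monoid_scheme \<Rightarrow> 'a set \<Rightarrow> bool" where
  "virtually_normal G J \<longleftrightarrow>
     subgroup J G \<and> (\<exists>K. K \<subseteq> J \<and> K \<lhd> G \<and> finite_index G J K)"

(* In the next two definitions the family may be infinite. Requiring it to be nonempty
   excludes nothing: the empty intersection, carrier G, is itself an admissible member. *)

definition weakly_separable :: "('a, 'b) monoid_scheme \<Rightarrow> 'a set \<Rightarrow> bool" where
  "weakly_separable G H \<longleftrightarrow>
     subgroup H G \<and>
     (\<exists>\<J>. \<J> \<noteq> {} \<and> (\<forall>J\<in>\<J>. virtually_normal G J) \<and> H = \<Inter>\<J>)"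

definition separable :: "('a, 'b) monoid_scheme \<Rightarrow> 'a set \<Rightarrow> bool" where
  "separable G H \<longleftrightarrow>
     subgroup H G \<and>
     (\<exists>\<J>. \<J> \<noteq> {} \<and> (\<forall>J\<in>\<J>. subgroup J G \<and> finite_index G (carrier G) J) \<and> H = \<Inter>\<J>)"

end

theory Submission
  imports Defs "HOL-Algebra.Group_Action"
begin

text \<open>Let \<open>G = \<langle>YH\<rangle>\<close> with \<open>Y\<close> finite and closed under inversion. Since \<open>H\<close> is commensurated,
  \<open>yHy\<inverse> \<subseteq> HA\<close> for some finite set \<open>A\<close> and all \<open>y \<in> Y\<close>. For each \<open>a \<in> A - H\<close> separability provides a
  member \<open>J\<^sub>a \<supseteq> H\<close> of the family with \<open>a \<notin> J\<^sub>a\<close>, and \<open>J\<^sub>a\<close> contains a subgroup \<open>K\<^sub>a\<close> of finite index that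
  is normal in \<open>G\<close>. Let \<open>N\<close> be the intersection of \<open>H\<close> with these finitely many \<open>K\<^sub>a\<close>. For \<open>n \<in> N\<close> and
  \<open>y \<in> Y\<close> write \<open>yny\<inverse> = ha\<close>. If \<open>a \<notin> H\<close>, then \<open>ha = yny\<inverse> \<in> K\<^sub>a \<subseteq> J\<^sub>a\<close> forces \<open>a \<in> J\<^sub>a\<close>, a contradiction.
  So \<open>yny\<inverse> \<in> H\<close>, hence \<open>N\<close> is normalized by \<open>Y\<close> and \<open>H\<close>. For the second part the \<open>K\<^sub>a\<close> can be
  chosen of finite index in \<open>G\<close>.\<close>

section \<open>Subgroups of finite index\<close>

text \<open>The right-hand side makes sense even when \<open>K\<close> is not contained in
  \<open>H\<close>: it counts the right cosets of \<open>K\<close> with a representative in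
  \<open>H\<close>. The later lemmas rely on this reading.\<close>

lemma finite_index_iff:
  fixes G (structure)
  shows "finite_index G H K \<longleftrightarrow> finite ((\<lambda>h. K #> h) ` H)"
proof -
  have "rcosets\<^bsub>G\<lparr>carrier := H\<rparr>\<^esub> K = (\<lambda>h. K #> h) ` H"
    by (auto simp: RCOSETS_def r_coset_def)
  then show ?thesis by (simp add: finite_index_def)
qed

lemma finite_index_self:
  fixes G (structure)
  assumes "group G" "subgroup H G"
  shows "finite_index G H H"
proof -
  interpret group G by fact
  have "(\<lambda>h. H #> h) ` H \<subseteq> {H}"
    using assms(2) by (auto simp: coset_join2 subgroup.mem_carrier)
  then show ?thesis
    unfolding finite_index_iff by (rule finite_subset) simp
qed

lemma finite_index_mono:
  assumes "finite_index G J K" "H \<subseteq> J"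
  shows "finite_index G H K"
  using assms unfolding finite_index_iff by (meson finite_subset image_mono)

lemma finite_index_representatives:
  fixes G (structure)
  assumes "group G" "K \<subseteq> carrier G" "\<one> \<in> K" "H \<subseteq> carrier G"
    and "finite_index G H K"
  obtains A where "finite A" "A \<subseteq> H" "\<And>h. h \<in> H \<Longrightarrow> \<exists>k\<in>K. \<exists>a\<in>A. h = k \<otimes> a"
proof -
  interpret group G by fact
  obtain A where A: "A \<subseteq> H" "finite A" "(\<lambda>h. K #> h) ` H = (\<lambda>h. K #> h) ` A"
    using finite_subset_image[of "(\<lambda>h. K #> h) ` H" "\<lambda>h. K #> h" H] assms(5)
    unfolding finite_index_iff by auto
  have "\<exists>k\<in>K. \<exists>a\<in>A. h = k \<otimes> a" if h: "h \<in> H" for h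
  proof -
    obtain a where a: "a \<in> A" "K #> h = K #> a" using A(3) h by blast
    have "h \<in> K #> h" using h assms(3,4) by (force simp: r_coset_def)
    with a show ?thesis by (auto simp: r_coset_def)
  qed
  with A that show thesis by blast
qed

text \<open>By right cancellation, a coset of the intersection is the intersection of the two
  cosets, so it is determined by a pair from a finite product.\<close>

lemma finite_index_Int:
  fixes G (structure)
  assumes "group G" "M \<subseteq> carrier G" "K \<subseteq> carrier G" "H \<subseteq> carrier G"
    and "finite_index G H M" "finite_index G H K"
  shows "finite_index G H (M \<inter> K)"
proof -
  interpret group G by fact
  have "(M \<inter> K) #> h = (M #> h) \<inter> (K #> h)" if "h \<in> H" for h
    using assms(2-4) that unfolding r_coset_def
    by auto (metis IntI right_cancel subsetD)
  then have "(\<lambda>h. (M \<inter> K) #> h) ` H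
      \<subseteq> (\<lambda>(S, T). S \<inter> T) ` ((\<lambda>h. M #> h) ` H \<times> (\<lambda>h. K #> h) ` H)"
    by force
  with assms(5,6) show ?thesis
    unfolding finite_index_iff by (meson finite_SigmaI finite_imageI finite_subset)
qed

lemma finite_index_INT:
  fixes G (structure)
  assumes "group G" "subgroup H G" "finite F"
    and "\<And>J. J \<in> F \<Longrightarrow> k J \<subseteq> carrier G" "\<And>J. J \<in> F \<Longrightarrow> finite_index G H (k J)"
  shows "finite_index G H (H \<inter> (\<Inter>J\<in>F. k J))"
  using assms(3-)
proof (induction F)
  case empty
  then show ?case using finite_index_self[OF assms(1,2)] by simp
next
  case (insert J F)
  have H: "H \<subseteq> carrier G" using assms(2) by (rule subgroup.subset)
  have "finite_index G H ((H \<inter> (\<Inter>J\<in>F. k J)) \<inter> k J)"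
    using finite_index_Int[OF assms(1) _ _ H] insert H by (simp add: le_infI1)
  also have "(H \<inter> (\<Inter>J\<in>F. k J)) \<inter> k J = H \<inter> (\<Inter>J\<in>insert J F. k J)" by auto
  finally show ?case .
qed

text \<open>The subgroup is the kernel of the action of \<open>G\<close> on the right cosets of \<open>J\<close>.\<close>

lemma finite_index_normal_core:
  fixes G (structure)
  assumes "group G" "subgroup J G" "finite_index G (carrier G) J"
  obtains K where "K \<subseteq> J" "K \<lhd> G" "finite_index G (carrier G) K"
proof -
  interpret group G by fact
  have J: "J \<subseteq> carrier G" using assms(2) by (rule subgroup.subset)
  define R where "R = (\<lambda>h. J #> h) ` carrier G"
  define K where "K = {x \<in> carrier G. \<forall>C\<in>R. C #> x = C}"
  have finR: "finite R" using assms(3) unfolding finite_index_iff R_def .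
  have Rc: "C \<subseteq> carrier G" if "C \<in> R" for C
    using that J by (auto simp: R_def r_coset_def)
  have Rm: "C #> x \<in> R" if "C \<in> R" "x \<in> carrier G" for C x
    using that J by (auto simp: R_def coset_mult_assoc)
  have inv_move: "C #> (x \<otimes> inv y) = C \<longleftrightarrow> C #> x = C #> y"
    if "C \<in> R" "x \<in> carrier G" "y \<in> carrier G" for C x y
    using coset_mult_inv1[of C x y] coset_mult_inv2[of C x y] Rc[OF that(1)] that(2,3) by auto
  have KJ: "K \<subseteq> J"
  proof
    fix x assume x: "x \<in> K"
    have "J \<in> R" 
      unfolding R_def by (rule image_eqI[where x = \<one>]) (simp_all add: coset_mult_one J)
    with x have "J #> x = J" "x \<in> carrier G" by (auto simp: K_def)
    then show "x \<in> J" using assms(2) coset_join1 by blast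
  qed
  have subK: "subgroup K G"
  proof (rule subgroupI)
    show "K \<noteq> {}" using Rc coset_mult_one by (auto simp: K_def)
  next
    fix x assume "x \<in> K"
    then show "inv x \<in> K"
      using inv_move[of _ "\<one>" x] Rc by (auto simp: K_def coset_mult_one)
  next
    fix x y assume "x \<in> K" "y \<in> K"
    then show "x \<otimes> y \<in> K"
      using Rc by (auto simp: K_def coset_mult_assoc[symmetric])
  qed (auto simp: K_def)
  have normK: "K \<lhd> G"
    unfolding normal_inv_iff
  proof (intro conjI ballI subK)
    fix x h assume x: "x \<in> carrier G" and h: "h \<in> K"
    have hc: "h \<in> carrier G" using h by (simp add: K_def)
    have "C #> (x \<otimes> h \<otimes> inv x) = C" if C: "C \<in> R" for C
    proof -
      have "C #> (x \<otimes> h) = (C #> x) #> h"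
        using Rc[OF C] x hc by (simp add: coset_mult_assoc)
      also have "\<dots> = C #> x" using h Rm[OF C x] by (simp add: K_def)
      finally show ?thesis using C x hc by (simp add: inv_move)
    qed
    then show "x \<otimes> h \<otimes> inv x \<in> K" using x hc by (simp add: K_def)
  qed
  have "finite_index G (carrier G) K"
  proof -
    \<comment> \<open>\<open>restrict\<close> places \<open>act x\<close> in the finite set
      \<open>R \<rightarrow>\<^sub>E R\<close>. Elements acting equally differ by an element of the
      kernel, so \<open>K #> x\<close> depends only on \<open>act x\<close>, and there are only
      finitely many such cosets.\<close>
    define act where "act x = restrict (\<lambda>C. C #> x) R" for x
    have act_eq: "K #> x = K #> y"
      if "x \<in> carrier G" "y \<in> carrier G" "act x = act y" for x y
    proof -
      have "C #> x = C #> y" if "C \<in> R" for C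
        using fun_cong[OF \<open>act x = act y\<close>, of C] that by (simp add: act_def)
      then have "x \<otimes> inv y \<in> K" using that(1,2) by (simp add: K_def inv_move)
      then show ?thesis
        using that(1,2) subK
        by (metis coset_join2 coset_mult_inv1 inv_closed m_closed subgroup.subset)
    qed
    have "finite (act ` carrier G)"
    proof (rule finite_subset)
      show "act ` carrier G \<subseteq> R \<rightarrow>\<^sub>E R" using Rm by (auto simp: act_def)
      show "finite (R \<rightarrow>\<^sub>E R)" using finR by (intro finite_PiE) auto
    qed
    moreover have "(\<lambda>x. K #> x) ` carrier G
        \<subseteq> (\<lambda>f. K #> inv_into (carrier G) act f) ` act ` carrier G"
    proof clarify
      fix x assume x: "x \<in> carrier G"
      then have "K #> x = K #> inv_into (carrier G) act (act x)"
        by (intro act_eq) (auto simp: inv_into_into f_inv_into_f)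
      with x show "K #> x \<in> (\<lambda>f. K #> inv_into (carrier G) act f) ` act ` carrier G" by blast
    qed
    ultimately show ?thesis
      unfolding finite_index_iff by (meson finite_imageI finite_subset)
  qed
  with KJ normK that show thesis by blast
qed

section \<open>Conjugates of a commensurated subgroup\<close>

text \<open>Conjugation by \<open>g\<close> sends a subgroup \<open>L\<close> of finite index in
  \<open>H\<close> into \<open>H\<close>, so the \<open>g\<close>-conjugates of coset
  representatives of \<open>L\<close> in \<open>H\<close> suffice.\<close>

lemma commensurated_conjugate_cover:
  fixes G (structure)
  assumes "group G" "commensurated G H" "g \<in> carrier G"
  obtains A where "finite A" "A \<subseteq> carrier G"
    "\<And>h. h \<in> H \<Longrightarrow> \<exists>k\<in>H. \<exists>a\<in>A. g \<otimes> h \<otimes> inv g = k \<otimes> a"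
proof -
  interpret group G by fact
  interpret H: subgroup H G using assms(2) by (simp add: commensurated_def)
  \<comment> \<open>Commensuration is applied to \<open>inv g\<close>, because it is conjugation by
    \<open>g\<close> that has to bring \<open>L\<close> back into \<open>H\<close>.\<close>
  define L where "L = H \<inter> ((inv g <# H) #> g)"
  have "finite_index G H L"
    using assms(2,3) inv_inv[OF assms(3)] unfolding commensurated_def L_def
    by (metis inv_closed)
  moreover have "\<one> \<in> L"
  proof -
    have "inv g \<otimes> \<one> \<in> inv g <# H"
      unfolding l_coset_def using H.one_closed by blast
    then have "inv g \<otimes> \<one> \<otimes> g \<in> (inv g <# H) #> g" unfolding r_coset_def by blast
    with assms(3) show ?thesis by (simp add: L_def)
  qed
  moreover have "L \<subseteq> carrier G" by (auto simp: L_def)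
  ultimately obtain A where A: "finite A" "A \<subseteq> H"
    "\<And>h. h \<in> H \<Longrightarrow> \<exists>l\<in>L. \<exists>a\<in>A. h = l \<otimes> a"
    using finite_index_representatives[OF assms(1) _ _ H.subset, of L] by blast
  have conj: "g \<otimes> l \<otimes> inv g \<in> H" if "l \<in> L" for l
  proof -
    obtain h where h: "h \<in> H" "l = inv g \<otimes> h \<otimes> g"
      using \<open>l \<in> L\<close> unfolding L_def r_coset_def l_coset_def by blast
    then have "g \<otimes> l \<otimes> inv g = h"
      using assms(3) conjugation_is_surj[of g h] by simp
    with h show ?thesis by simp
  qed
  show thesis
  proof
    show "finite ((\<lambda>a. g \<otimes> a \<otimes> inv g) ` A)" using A(1) by simp
    show "(\<lambda>a. g \<otimes> a \<otimes> inv g) ` A \<subseteq> carrier G" using A(2) assms(3) by auto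
  next
    fix h assume "h \<in> H"
    then obtain l a where la: "l \<in> L" "a \<in> A" "h = l \<otimes> a" using A(3) by blast
    have c: "l \<in> carrier G" "a \<in> carrier G" using la A(2) by (auto simp: L_def)
    have "inv g \<otimes> (g \<otimes> (a \<otimes> inv g)) = a \<otimes> inv g"
      using c assms(3) by (simp add: m_assoc[symmetric])
    then have "g \<otimes> h \<otimes> inv g = (g \<otimes> l \<otimes> inv g) \<otimes> (g \<otimes> a \<otimes> inv g)"
      using c assms(3) la(3) by (simp add: m_assoc)
    with conj[OF la(1)] la(2)
    show "\<exists>k\<in>H. \<exists>b\<in>(\<lambda>a. g \<otimes> a \<otimes> inv g) ` A. g \<otimes> h \<otimes> inv g = k \<otimes> b" by blast
  qed
qed

section \<open>Construction of the normal subgroup\<close>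

text \<open>The elements conjugating \<open>N\<close> into \<open>N\<close> are closed under
  products. In general they are not closed under inverses, since the image may be a proper subgroup
  of \<open>N\<close>; hence the separate condition on \<open>inv s\<close>.\<close>

lemma normal_if_conjugates_by_generators:
  fixes G (structure)
  assumes "group G" "subgroup N G" "S \<subseteq> carrier G" "generate G S = carrier G"
    and conj: "\<And>s n. s \<in> S \<Longrightarrow> n \<in> N \<Longrightarrow> s \<otimes> n \<otimes> inv s \<in> N"
      "\<And>s n. s \<in> S \<Longrightarrow> n \<in> N \<Longrightarrow> inv s \<otimes> n \<otimes> s \<in> N"
  shows "N \<lhd> G"
proof -
  interpret group G by fact
  interpret N: subgroup N G by fact
  have "\<forall>n\<in>N. x \<otimes> n \<otimes> inv x \<in> N" if "x \<in> generate G S" for x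
    using that
  proof (induction rule: generate.induct)
    case one
    then show ?case by simp
  next
    case (incl s)
    then show ?case using conj(1) by blast
  next
    case (inv s)
    then show ?case using conj(2) assms(3) by auto
  next
    case (eng x y)
    have c: "x \<in> carrier G" "y \<in> carrier G"
      using eng.hyps generate_in_carrier[OF assms(3)] by auto
    have "x \<otimes> y \<otimes> n \<otimes> inv (x \<otimes> y) = x \<otimes> (y \<otimes> n \<otimes> inv y) \<otimes> inv x" if "n \<in> N" for n
      using c that by (simp add: m_assoc inv_mult_group)
    with eng.IH show ?case by simp
  qed
  with assms(2,4) show ?thesis by (simp add: normal_inv_iff)
qed

text \<open>Common core of both parts. The choice of \<open>k\<close> is left to the caller, and
  \<open>F\<close> is returned so that the normal subgroup can be rewritten as an intersection of
  members of a family.\<close>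

lemma commensurated_normal_trace:
  fixes G (structure)
  assumes "group G" "commensurated G H" "generated_by_finitely_many_cosets G H"
    and H_eq: "H = \<Inter>\<J>"
    and sub: "\<And>J. J \<in> \<J> \<Longrightarrow> subgroup J G"
    and K: "\<And>J. J \<in> \<J> \<Longrightarrow> k J \<subseteq> J" "\<And>J. J \<in> \<J> \<Longrightarrow> k J \<lhd> G"
    and fin: "\<And>J. J \<in> \<J> \<Longrightarrow> finite_index G J (k J)"
  obtains F where "F \<subseteq> \<J>" "H \<inter> (\<Inter>J\<in>F. k J) \<lhd> G"
    "finite_index G H (H \<inter> (\<Inter>J\<in>F. k J))"
proof -
  interpret group G by fact
  have subH: "subgroup H G" using assms(2) by (simp add: commensurated_def)
  interpret H: subgroup H G by fact
  obtain Y where Y: "finite Y" "Y \<subseteq> carrier G" "generate G (Y <#> H) = carrier G"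
    using assms(3) by (auto simp: generated_by_finitely_many_cosets_def)
  \<comment> \<open>Inverses are added because normality is tested on the generators and on their
    inverses.\<close>
  define Z where "Z = Y \<union> (\<lambda>y. inv y) ` Y"
  have Z: "finite Z" "Z \<subseteq> carrier G" using Y by (auto simp: Z_def)
  have "\<exists>A. finite A \<and> A \<subseteq> carrier G \<and>
      (\<forall>h\<in>H. \<exists>k\<in>H. \<exists>a\<in>A. z \<otimes> h \<otimes> inv z = k \<otimes> a)" if "z \<in> Z" for z
  proof -
    have "z \<in> carrier G" using that Z(2) by blast
    then show ?thesis
      by (rule commensurated_conjugate_cover[OF assms(1,2)]) (intro exI conjI ballI)
  qed
  then obtain A where A: "\<And>z. z \<in> Z \<Longrightarrow> finite (A z)" "\<And>z. z \<in> Z \<Longrightarrow> A z \<subseteq> carrier G"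
    "\<And>z h. z \<in> Z \<Longrightarrow> h \<in> H \<Longrightarrow> \<exists>k\<in>H. \<exists>a\<in>A z. z \<otimes> h \<otimes> inv z = k \<otimes> a"
    by metis
  have "\<forall>a. a \<notin> H \<longrightarrow> (\<exists>J\<in>\<J>. a \<notin> J)" using H_eq by blast
  then obtain j where j: "\<And>a. a \<notin> H \<Longrightarrow> j a \<in> \<J>" "\<And>a. a \<notin> H \<Longrightarrow> a \<notin> j a" by metis
  define F where "F = j ` ((\<Union>z\<in>Z. A z) - H)"
  have F: "finite F" "F \<subseteq> \<J>" using Z(1) A(1) j(1) by (auto simp: F_def)
  define N where "N = H \<inter> (\<Inter>J\<in>F. k J)"
  have kc: "k J \<subseteq> carrier G" if "J \<in> F" for J
    using that F(2) K(1) sub subgroup.subset by (metis subset_eq)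
  have HJ: "H \<subseteq> J" if "J \<in> F" for J using that F(2) H_eq by blast
  \<comment> \<open>\<open>k J\<close> need not lie in \<open>H\<close>; the index in
    \<open>J\<close> is restricted along \<open>H \<subseteq> J\<close>.\<close>
  have "finite_index G H (k J)" if "J \<in> F" for J
    using that F(2) fin HJ by (meson finite_index_mono subsetD)
  then have finN: "finite_index G H N"
    unfolding N_def using F(1) kc by (intro finite_index_INT assms(1) subH)
  have subk: "subgroup (k J) G" if "J \<in> F" for J
    using that F(2) K(2) normal_imp_subgroup by blast
  have subN: "subgroup N G"
  proof -
    have "subgroup (\<Inter>(insert H (k ` F))) G"
      using subH subk by (intro subgroups_Inter) auto
    then show ?thesis by (simp add: N_def)
  qed
  \<comment> \<open>Normality of each \<open>k J\<close> settles this half of membership in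
    \<open>N\<close>; only membership in \<open>H\<close> then needs an argument.\<close>
  have conj_k: "x \<otimes> n \<otimes> inv x \<in> k J" if "x \<in> carrier G" "n \<in> N" "J \<in> F" for x n J
    using that F(2) K(2) by (auto simp: N_def intro: normal.inv_op_closed2)
  have conj_H: "h \<otimes> n \<otimes> inv h \<in> N" if "h \<in> H" "n \<in> N" for h n
    using that conj_k by (auto simp: N_def)
  have conj_Z: "z \<otimes> n \<otimes> inv z \<in> N" if z: "z \<in> Z" and n: "n \<in> N" for z n
  proof -
    have "n \<in> H" using n by (simp add: N_def)
    from A(3)[OF z this] obtain h a
      where ha: "h \<in> H" "a \<in> A z" "z \<otimes> n \<otimes> inv z = h \<otimes> a"
      by (elim bexE)
    have ac: "a \<in> carrier G" using ha(2) A(2) z by blast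
    have "a \<in> H"
    proof (rule ccontr)
      assume a: "a \<notin> H"
      then have ja: "j a \<in> F" using ha(2) z by (auto simp: F_def)
      interpret J: subgroup "j a" G using sub j(1) a by blast
      have "h \<otimes> a \<in> j a"
        using conj_k[OF _ n ja, of z] z Z(2) K(1) j(1)[OF a] ha(3) by auto
      moreover have "inv h \<in> j a" using ha(1) HJ[OF ja] by auto
      ultimately have "inv h \<otimes> (h \<otimes> a) \<in> j a" by simp
      then show False using j(2)[OF a] ha(1) ac by (simp add: m_assoc[symmetric])
    qed
    then have "z \<otimes> n \<otimes> inv z \<in> H" using ha(1,3) by simp
    moreover have "z \<otimes> n \<otimes> inv z \<in> k J" if "J \<in> F" for J
      using conj_k[OF _ n that] z Z(2) by blast
    ultimately show ?thesis unfolding N_def by blast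
  qed
  have "N \<lhd> G"
  proof (rule normal_if_conjugates_by_generators[OF assms(1) subN _ Y(3)])
    show "Y <#> H \<subseteq> carrier G" using Y(2) by (simp add: set_mult_closed H.subset)
  next
    fix s n assume s: "s \<in> Y <#> H" and n: "n \<in> N"
    obtain y h where yh: "y \<in> Y" "h \<in> H" "s = y \<otimes> h" using s by (auto simp: set_mult_def)
    have c: "y \<in> carrier G" "h \<in> carrier G" "n \<in> carrier G"
      using yh Y(2) n by (auto simp: N_def)
    have "y \<otimes> (h \<otimes> n \<otimes> inv h) \<otimes> inv y \<in> N"
      using yh n by (intro conj_Z conj_H) (auto simp: Z_def)
    then show "s \<otimes> n \<otimes> inv s \<in> N"
      using c yh(3) by (simp add: m_assoc inv_mult_group)
    \<comment> \<open>Inversion swaps the factors of \<open>s = y \<otimes> h\<close>: conjugate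
      first by \<open>inv y\<close>, which is in \<open>Z\<close>, then by \<open>inv h\<close>,
      which is in \<open>H\<close>. The double inverses match \<open>conj_Z\<close> and
      \<open>conj_H\<close>.\<close>
    have "inv h \<otimes> (inv y \<otimes> n \<otimes> inv (inv y)) \<otimes> inv (inv h) \<in> N"
      using yh n by (intro conj_Z conj_H) (auto simp: Z_def)
    then show "inv s \<otimes> n \<otimes> s \<in> N"
      using c yh(3) by (simp add: m_assoc inv_mult_group)
  qed
  with F(2) finN that show thesis by (simp add: N_def)
qed

theorem corollary7:
  fixes G :: "('a, 'b) monoid_scheme" and H :: "'a set"
  assumes "group G"
    and "commensurated G H"
    and "generated_by_finitely_many_cosets G H"
  shows "(weakly_separable G H \<longrightarrow>
            (\<exists>N. N \<subseteq> H \<and> N \<lhd> G \<and> finite_index G H N)) \<and>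
         (separable G H \<longrightarrow>
            (\<exists>N. N \<subseteq> H \<and> N \<lhd> G \<and> separable G N \<and> finite_index G H N))"
proof (intro conjI impI)
  assume "weakly_separable G H"
  then obtain \<J> where J: "\<J> \<noteq> {}" "\<And>J. J \<in> \<J> \<Longrightarrow> virtually_normal G J" "H = \<Inter>\<J>"
    by (auto simp: weakly_separable_def)
  obtain k where k: "\<And>J. J \<in> \<J> \<Longrightarrow> k J \<subseteq> J" "\<And>J. J \<in> \<J> \<Longrightarrow> k J \<lhd> G"
    "\<And>J. J \<in> \<J> \<Longrightarrow> finite_index G J (k J)"
    using J(2) unfolding virtually_normal_def by metis
  obtain F where "H \<inter> (\<Inter>J\<in>F. k J) \<lhd> G" "finite_index G H (H \<inter> (\<Inter>J\<in>F. k J))"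
    using commensurated_normal_trace[OF assms J(3) _ k] J(2) by (metis virtually_normal_def)
  then show "\<exists>N. N \<subseteq> H \<and> N \<lhd> G \<and> finite_index G H N" by blast
next
  assume "separable G H"
  then obtain \<J> where J: "\<J> \<noteq> {}" "\<And>J. J \<in> \<J> \<Longrightarrow> subgroup J G"
    "\<And>J. J \<in> \<J> \<Longrightarrow> finite_index G (carrier G) J" "H = \<Inter>\<J>"
    by (auto simp: separable_def)
  have "\<forall>J\<in>\<J>. \<exists>K. K \<subseteq> J \<and> K \<lhd> G \<and> finite_index G (carrier G) K"
    using finite_index_normal_core[OF assms(1)] J(2,3) by metis
  then obtain k where k: "\<And>J. J \<in> \<J> \<Longrightarrow> k J \<subseteq> J" "\<And>J. J \<in> \<J> \<Longrightarrow> k J \<lhd> G"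
    "\<And>J. J \<in> \<J> \<Longrightarrow> finite_index G (carrier G) (k J)"
    by metis
  have "finite_index G J (k J)" if "J \<in> \<J>" for J
    using k(3) J(2) that by (meson finite_index_mono subgroup.subset)
  then obtain F where F: "F \<subseteq> \<J>" "H \<inter> (\<Inter>J\<in>F. k J) \<lhd> G"
    "finite_index G H (H \<inter> (\<Inter>J\<in>F. k J))"
    using commensurated_normal_trace[OF assms J(4,2) k(1,2)] by metis
  have "separable G (H \<inter> (\<Inter>J\<in>F. k J))"
    unfolding separable_def
  proof (intro conjI exI)
    show "subgroup (H \<inter> (\<Inter>J\<in>F. k J)) G" using F(2) by (rule normal_imp_subgroup)
    \<comment> \<open>\<open>\<J>\<close> itself contributes the factor \<open>H\<close> and keeps
      the family nonempty when \<open>F\<close> is empty.\<close>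
    show "\<J> \<union> k ` F \<noteq> {}" using J(1) by simp
    show "H \<inter> (\<Inter>J\<in>F. k J) = \<Inter>(\<J> \<union> k ` F)" using J(4) by blast
    show "\<forall>J\<in>\<J> \<union> k ` F. subgroup J G \<and> finite_index G (carrier G) J"
      using J(2,3) k(2,3) subsetD[OF F(1)] by (auto intro: normal_imp_subgroup)
  qed
  with F(2,3) show "\<exists>N. N \<subseteq> H \<and> N \<lhd> G \<and> separable G N \<and> finite_index G H N" by blast
qed

end
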